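(* Let $E$ and $X$ be Banach spaces ordered by the closed and pointed cones $P\subseteq E$ and $Q\subseteq X$ respectively. Suppose that $P$ gives an open decomposition in $E$. If $Q$ is a reflexive (respectively, strongly reflexive) cone of $X$, then any positive linear operator $T:E\to X$ is weakly compact (respectively, compact).
   Context: All spaces are real. $B_X$ is the closed unit ball of $X$. A cone of $X$ is a nonempty convex set $P\subseteq X$ with $\lambda P\subseteq P$ for every real $\lambda\ge 0$; it is pointed if $P\cap(-P)=\{0\}$. A cone $Q$ of a Banach space $X$ is reflexive if $Q\cap B_X$ is weakly compact, and strongly reflexive if $Q\cap B_X$ is norm compact. A cone $P$ gives an open decomposition in $E$ if there is $\rho>0$ with $\rho B_E\subseteq B_E^+-B_E^+$, where $B_E^+=B_E\cap P$. A linear operator $T:E\to X$ (not assumed continuous) is positive if $T(P)\subseteq Q$. It is weakly compact (compact) if it maps $B_E$ to a relatively weakly compact (relatively norm compact) set. *)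

theory Defs
  imports "HOL-Analysis.Analysis"
begin

text \<open>
  The weak topology of a real normed space: the coarsest topology on the whole space that makes
  every continuous linear functional continuous.
\<close>

definition weak_topology :: "'a::real_normed_vector topology" where
  "weak_topology =
    topology_generated_by {f -` U | (f :: 'a \<Rightarrow> real) U. bounded_linear f \<and> open U}"

lemma topspace_weak_topology [simp]: "topspace weak_topology = UNIV"
proof -
  have "bounded_linear (\<lambda>_ :: 'a. 0 :: real)"
    by (rule bounded_linear_zero)
  then have "UNIV \<in> {f -` U | (f :: 'a \<Rightarrow> real) U. bounded_linear f \<and> open U}"
    using open_UNIV vimage_UNIV by blast
  then show ?thesis
    unfolding weak_topology_def topology_generated_by_topspace by blast
qed

text \<open>
  A cone (nonempty, convex, closed under multiplication by nonnegative reals) is the library's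
  \<^const>\<open>convex_cone\<close>; the library's \<^const>\<open>cone\<close> requires neither
  nonemptiness nor convexity. The predicates below are meant for sets that are cones in this sense.
\<close>

definition pointed :: "'a::real_vector set \<Rightarrow> bool" where
  "pointed P \<longleftrightarrow> P \<inter> uminus ` P = {0}"

definition reflexive_cone :: "'a::real_normed_vector set \<Rightarrow> bool" where
  "reflexive_cone Q \<longleftrightarrow> compactin weak_topology (Q \<inter> cball 0 1)"

definition strongly_reflexive_cone :: "'a::real_normed_vector set \<Rightarrow> bool" where
  "strongly_reflexive_cone Q \<longleftrightarrow> compact (Q \<inter> cball 0 1)"

definition gives_open_decomposition :: "'a::real_normed_vector set \<Rightarrow> bool" where
  "gives_open_decomposition P \<longleftrightarrow>
    (\<exists>\<rho>>0. (*\<^sub>R) \<rho> ` cball 0 1 \<subseteq> {x - y | x y. x \<in> cball 0 1 \<inter> P \<and> y \<in> cball 0 1 \<inter> P})"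

definition positive_operator :: "'a set \<Rightarrow> 'b set \<Rightarrow> ('a \<Rightarrow> 'b) \<Rightarrow> bool" where
  "positive_operator P Q T \<longleftrightarrow> T ` P \<subseteq> Q"

definition weakly_compact_operator ::
    "('a::real_normed_vector \<Rightarrow> 'b::real_normed_vector) \<Rightarrow> bool" where
  "weakly_compact_operator T \<longleftrightarrow>
    compactin weak_topology (weak_topology closure_of (T ` cball 0 1))"

definition compact_operator ::
    "('a::real_normed_vector \<Rightarrow> 'b::real_normed_vector) \<Rightarrow> bool" where
  "compact_operator T \<longleftrightarrow> compact (closure (T ` cball 0 1))"

end

theory Submission
  imports Defs
begin

text \<open>
  A positive operator maps the positive part of the unit ball into \<open>Q\<close>, and the open
  decomposition recovers the whole ball from differences of positive elements. So once \<open>T\<close> is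
  known to be bounded, \<open>T ` cball 0 1\<close> lies in a multiple of the difference set \<open>K - K\<close> with
  \<open>K = Q \<inter> cball 0 1\<close> (\<open>positive_operator_image_cball\<close>). This difference set inherits weak or
  norm compactness from \<open>K\<close>, because subtraction and scaling are continuous for either topology.

  Two points need work. The first is that \<open>T\<close> is bounded. Order intervals of \<open>Q\<close> may be
  unbounded, since \<open>Q\<close> need not be normal, so dominating a sequence in norm by a single positive
  element does not suffice; but \<open>Q\<close> is closed and pointed, and that makes the graph of
  \<open>T\<close> closed. If \<open>z n\<close> tends to 0 fast, the decomposition provides one positive \<open>s\<close> with
  \<open>z n + s / 2^n \<in> P\<close> for all \<open>n\<close>. Applying \<open>T\<close> shows that every limit of \<open>T (z n)\<close>
  lies in \<open>Q\<close>, and by symmetry in \<open>-Q\<close>, hence is 0. The closed graph theorem, derived here from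
  Baire's category theorem, gives \<open>positive_operator_bounded_linear\<close>.

  The second is that the weak closure of a subset of a weakly compact set is weakly compact.
  This holds in every regular space, and the weak topology is regular because it is generated by
  real functions.
\<close>

section \<open>The closed graph theorem\<close>

text \<open>
  The category step of the closed graph theorem, valid for an arbitrary linear map on a Banach space:
  some sublevel set of \<open>norm (T x)\<close> is dense in a ball by Baire, and convexity and symmetry move
  that ball to the origin. So each \<open>x\<close> has an approximation on which \<open>T\<close> is bounded, with relative
  error one half, ready to be iterated.
\<close>

lemma linear_almost_bounded:
  fixes T :: "'a::banach \<Rightarrow> 'b::real_normed_vector"
  assumes "linear T"
  obtains M where "M \<ge> 0" and "\<And>x. \<exists>a. norm (T a) \<le> M * norm x \<and> norm (x - a) \<le> norm x / 2"
proof -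
  interpret linear T by fact
  define A where "A n = {x. norm (T x) \<le> real n}" for n
  obtain n where "interior (closure (A n)) \<noteq> {}"
  proof -
    have "interior (\<Union>n. closure (A n)) = UNIV"
    proof -
      have "x \<in> (\<Union>n. closure (A n))" for x
      proof -
        obtain n where "norm (T x) \<le> real n"
          using real_arch_simple by blast
        then have "x \<in> A n"
          by (simp add: A_def)
        then show ?thesis
          using closure_subset by blast
      qed
      then have "(\<Union>n. closure (A n)) = UNIV"
        by blast
      then show ?thesis
        by simp
    qed
    moreover have "interior (\<Union>n. closure (A n)) = {}" if "\<And>n. interior (closure (A n)) = {}"
      using Baire_category_alt[of "euclidean :: 'a topology" "range (\<lambda>n. closure (A n))"] that
        completely_metrizable_space_euclidean
      by auto
    ultimately show ?thesis
      using that by (metis UNIV_not_empty)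
  qed
  then obtain x0 r where "r > 0" and ball: "ball x0 r \<subseteq> closure (A n)"
    by (metis ex_in_conv mem_interior)
  \<comment> \<open>\<open>x\<close> is half the difference of \<open>x0 + x\<close> and \<open>x0 - x\<close>, and \<open>A n\<close> is convex and symmetric.\<close>
  have dense: "\<exists>a. norm (T a) \<le> n \<and> norm (x - a) < e" if "norm x < r" "e > 0" for x e
  proof -
    have "x0 + x \<in> closure (A n)" "x0 - x \<in> closure (A n)"
      using ball that by (auto simp: subset_iff dist_norm)
    then obtain a b where a: "a \<in> A n" "dist a (x0 + x) < e" and b: "b \<in> A n" "dist b (x0 - x) < e"
      using \<open>e > 0\<close> unfolding closure_approachable by blast
    have "norm (T ((1/2) *\<^sub>R (a - b))) \<le> n"
      using a(1) b(1) norm_triangle_ineq4[of "T a" "T b"] by (simp add: A_def scale diff)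
    moreover have "x - (1/2) *\<^sub>R (a - b) = (1/2) *\<^sub>R ((x0 + x - a) - (x0 - x - b))"
      by (simp add: algebra_simps flip: scaleR_2)
    then have "norm (x - (1/2) *\<^sub>R (a - b)) < e"
      using a(2) b(2) norm_triangle_ineq4[of "x0 + x - a" "x0 - x - b"]
      by (simp add: dist_norm norm_minus_commute)
    ultimately show ?thesis
      by blast
  qed
  show thesis
  proof
    show "2 * n / r \<ge> 0"
      using \<open>r > 0\<close> by simp
    show "\<exists>a. norm (T a) \<le> 2 * n / r * norm x \<and> norm (x - a) \<le> norm x / 2" for x
    proof (cases "x = 0")
      case True
      then show ?thesis
        by (intro exI[of _ 0]) (simp add: zero)
    next
      case False
      \<comment> \<open>Rescale \<open>x\<close> to norm \<open>r / 2\<close>; the error \<open>r / 4\<close> there is half of that norm.\<close>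
      define c where "c = 2 * norm x / r"
      have "c > 0"
        using False \<open>r > 0\<close> by (simp add: c_def)
      have "norm ((1/c) *\<^sub>R x) < r"
        using False \<open>r > 0\<close> by (simp add: c_def)
      then obtain a where a: "norm (T a) \<le> n" "norm ((1/c) *\<^sub>R x - a) < r/4"
        using dense[of "(1/c) *\<^sub>R x" "r/4"] \<open>r > 0\<close> by auto
      have "norm (T (c *\<^sub>R a)) \<le> c * n"
        using a(1) \<open>c > 0\<close> by (simp add: scale)
      moreover have "x - c *\<^sub>R a = c *\<^sub>R ((1/c) *\<^sub>R x - a)"
        using \<open>c > 0\<close> by (simp add: algebra_simps)
      then have "norm (x - c *\<^sub>R a) \<le> c * (r/4)"
        using a(2) \<open>c > 0\<close> by simp
      ultimately show ?thesis
        using \<open>r > 0\<close> by (intro exI[of _ "c *\<^sub>R a"]) (simp add: c_def mult_ac)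
    qed
  qed
qed

text \<open>
  Approximating the successive remainders writes \<open>x\<close> as a series whose image under \<open>T\<close> converges
  absolutely with sum of norm at most \<open>2 * M * norm x\<close>. Closedness of the graph identifies that
  sum with \<open>T x\<close>.
\<close>

theorem closed_graph_imp_bounded_linear:
  fixes T :: "'a::banach \<Rightarrow> 'b::banach"
  assumes "linear T" and graph: "closed (range (\<lambda>x. (x, T x)))"
  shows "bounded_linear T"
proof -
  interpret linear T by fact
  obtain M h where "M \<ge> 0" and Th: "\<And>x. norm (T (h x)) \<le> M * norm x"
    and h: "\<And>x. norm (x - h x) \<le> norm x / 2"
    using linear_almost_bounded[OF \<open>linear T\<close>] by metis
  have "norm (T x) \<le> norm x * (2 * M)" for x
  proof -
    define R where "R n = ((\<lambda>z. z - h z) ^^ n) x" for n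
    have R_Suc: "R (Suc n) = R n - h (R n)" and R_0: "R 0 = x" for n
      by (simp_all add: R_def)
    have norm_R: "norm (R n) \<le> norm x * (1/2)^n" for n
    proof (induction n)
      case (Suc n)
      then show ?case
        using h[of "R n"] by (simp add: R_Suc)
    qed (simp add: R_0)
    have sum_h: "(\<Sum>k<n. h (R k)) = x - R n" for n
      by (induction n) (simp_all add: R_0 R_Suc)
    have "R \<longlonglongrightarrow> 0"
    proof (rule Lim_null_comparison)
      show "\<forall>\<^sub>F n in sequentially. norm (R n) \<le> norm x * (1/2)^n"
        using norm_R by simp
      show "(\<lambda>n. norm x * (1/2)^n) \<longlonglongrightarrow> 0"
        by (intro tendsto_mult_right_zero LIMSEQ_power_zero) simp
    qed
    then have lim: "(\<lambda>n. x - R n) \<longlonglongrightarrow> x"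
      using tendsto_diff[OF tendsto_const] by fastforce
    define g where "g n = M * norm x * (1/2)^n" for n
    have "g sums (M * norm x * 2)"
      unfolding g_def using sums_mult[OF geometric_sums[of "1/2 :: real"]] by simp
    then have g: "summable g" "suminf g = M * norm x * 2"
      by (auto simp: sums_iff)
    have bound: "norm (T (h (R n))) \<le> g n" for n
      using order_trans[OF Th mult_left_mono[OF norm_R \<open>M \<ge> 0\<close>]] by (simp add: g_def mult.assoc)
    have summ: "summable (\<lambda>n. T (h (R n)))"
      using bound by (rule summable_comparison_test'[OF g(1)])
    have "(\<lambda>n. T (x - R n)) \<longlonglongrightarrow> (\<Sum>n. T (h (R n)))"
      using summable_LIMSEQ[OF summ] by (simp flip: sum sum_h)
    with lim have "(\<lambda>n. (x - R n, T (x - R n))) \<longlonglongrightarrow> (x, \<Sum>n. T (h (R n)))"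
      by (rule tendsto_Pair)
    then have "(x, \<Sum>n. T (h (R n))) \<in> range (\<lambda>x. (x, T x))"
      by (rule closed_sequentially[OF graph, rotated]) auto
    then have "T x = (\<Sum>n. T (h (R n)))"
      by auto
    also have "norm \<dots> \<le> suminf g"
      using norm_suminf_le[OF bound g(1)] .
    finally show ?thesis
      by (simp add: g(2) mult_ac)
  qed
  then show ?thesis
    using \<open>linear T\<close> by (meson bounded_linear_intro add scale)
qed

section \<open>Automatic continuity of positive operators\<close>

text \<open>
  Dropping one term leaves a series in the closed cone; so in its order the sum dominates each term.
\<close>

lemma suminf_minus_term_mem_closed_cone:
  fixes P :: "'a::real_normed_vector set"
  assumes P: "convex_cone P" "closed P" and c: "\<And>k. c k \<in> P" "summable c"
  shows "suminf c - c n \<in> P"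
proof -
  define d where "d k = c k - (if k = n then c k else 0)" for k
  have "d sums (suminf c - c n)"
    unfolding d_def by (intro sums_diff summable_sums c sums_single)
  moreover have "(\<Sum>k<N. d k) \<in> P" for N
  proof (induction N)
    case (Suc N)
    then show ?case
      using c(1) P(1) by (auto simp: d_def intro: convex_cone_add)
  qed (use P(1) convex_cone_contains_0 in auto)
  ultimately show ?thesis
    unfolding sums_def by (meson P(2) closed_sequentially)
qed

lemma open_decomposition_norm_bound:
  fixes P :: "'a::real_normed_vector set"
  assumes "gives_open_decomposition P" "convex_cone P"
  shows "\<exists>C>0. \<forall>x. \<exists>a\<in>P. \<exists>b\<in>P. x = a - b \<and> norm a \<le> C * norm x \<and> norm b \<le> C * norm x"
proof -
  obtain \<rho> where \<rho>: "\<rho> > 0"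
    "(*\<^sub>R) \<rho> ` cball 0 1 \<subseteq> {x - y | x y. x \<in> cball 0 1 \<inter> P \<and> y \<in> cball 0 1 \<inter> P}"
    using assms(1) unfolding gives_open_decomposition_def by blast
  show ?thesis
  proof (intro exI[of _ "1 / \<rho>"] conjI allI)
    show "1 / \<rho> > 0"
      using \<rho>(1) by simp
    fix x :: 'a
    define t where "t = norm x / \<rho>"
    have "t \<ge> 0"
      using \<rho>(1) by (simp add: t_def)
    have "\<rho> *\<^sub>R sgn x \<in> (*\<^sub>R) \<rho> ` cball 0 1"
      by (intro imageI) (simp add: norm_sgn)
    then obtain a b where ab: "\<rho> *\<^sub>R sgn x = a - b" "norm a \<le> 1" "norm b \<le> 1" "a \<in> P" "b \<in> P"
      using \<rho>(2) by fastforce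
    have "x = t *\<^sub>R (\<rho> *\<^sub>R sgn x)"
      using \<rho>(1) by (cases "x = 0") (simp_all add: t_def sgn_div_norm right_inverse)
    then have "x = t *\<^sub>R a - t *\<^sub>R b"
      by (simp add: ab(1) scaleR_diff_right)
    moreover have "norm (t *\<^sub>R a) \<le> 1 / \<rho> * norm x" "norm (t *\<^sub>R b) \<le> 1 / \<rho> * norm x"
      using mult_left_le[OF ab(2) \<open>t \<ge> 0\<close>] mult_left_le[OF ab(3) \<open>t \<ge> 0\<close>] \<rho>(1)
      by (simp_all add: t_def)
    moreover have "t *\<^sub>R a \<in> P" "t *\<^sub>R b \<in> P"
      using ab \<open>t \<ge> 0\<close> assms(2) convex_cone_scaleR by blast+
    ultimately show "\<exists>a\<in>P. \<exists>b\<in>P. x = a - b \<and> norm a \<le> 1/\<rho> * norm x \<and> norm b \<le> 1/\<rho> * norm x"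
      by blast
  qed
qed

text \<open>
  The one-sided half of the closed graph property. Write \<open>z n = a n - b n\<close> with positive parts of
  comparable norm. Along a fast subsequence the positive series \<open>s = \<Sum>n. 2^n b n\<close> converges and
  dominates each term, so \<open>z n \<ge> - b n \<ge> - s / 2^n\<close>. Positivity gives
  \<open>T (z n) + T s / 2^n \<in> Q\<close>, where the second summand vanishes in the limit although nothing is
  known about the size of \<open>T s\<close>.
\<close>

lemma positive_operator_null_sequence_limit:
  fixes P :: "'e::banach set" and Q :: "'x::banach set"
  assumes P: "convex_cone P" "closed P" "gives_open_decomposition P"
    and Q: "convex_cone Q" "closed Q"
    and T: "linear T" "positive_operator P Q T"
    and z: "z \<longlonglongrightarrow> 0" and Tz: "(\<lambda>n. T (z n)) \<longlonglongrightarrow> w"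
  shows "w \<in> Q"
proof -
  interpret linear T by fact
  obtain C where "C > 0" and
    "\<And>x. \<exists>a\<in>P. \<exists>b\<in>P. x = a - b \<and> norm a \<le> C * norm x \<and> norm b \<le> C * norm x"
    using open_decomposition_norm_bound[OF P(3,1)] by blast
  then obtain a b where ab: "\<And>x. a x \<in> P" "\<And>x. b x \<in> P" "\<And>x. x = a x - b x"
    and norm_b: "\<And>x. norm (b x) \<le> C * norm x"
    by metis
  \<comment> \<open>The rate 1/4 beats the weights \<open>2^n\<close> used below and leaves a geometric series.\<close>
  obtain r where r: "strict_mono r" and small: "\<And>n. norm (z (r n)) < (1/4)^n"
  proof -
    have "\<exists>m>k. norm (z m) < (1/4)^n" for n k
    proof -
      have "\<forall>\<^sub>F m in sequentially. norm (z m) < (1/4)^n"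
        by (rule order_tendstoD(2)[OF tendsto_norm_zero[OF z]]) simp
      then obtain N where "\<And>m. m \<ge> N \<Longrightarrow> norm (z m) < (1/4)^n"
        unfolding eventually_sequentially by blast
      then show ?thesis
        by (intro exI[of _ "max N (Suc k)"]) auto
    qed
    then have ex: "\<exists>m. m > k \<and> norm (z m) < (1/4)^n" for n k
      by blast
    define s where "s n k = (SOME m. m > k \<and> norm (z m) < (1/4)^n)" for n k
    have s: "s n k > k" "norm (z (s n k)) < (1/4)^n" for n k
      using someI_ex[OF ex[of k n]] by (simp_all add: s_def)
    define r where "r = rec_nat (s 0 0) (\<lambda>n k. s (Suc n) k)"
    have r_0: "r 0 = s 0 0" and r_Suc: "r (Suc n) = s (Suc n) (r n)" for n
      by (simp_all add: r_def)
    show thesis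
    proof
      show "strict_mono r"
        unfolding strict_mono_Suc_iff r_Suc using s(1) by blast
      show "norm (z (r n)) < (1/4)^n" for n
        using s(2) by (cases n) (simp_all only: r_0 r_Suc)
    qed
  qed
  define c where "c n = 2^n *\<^sub>R b (z (r n))" for n
  have c: "c n \<in> P" for n
    using P(1) ab(2) by (simp add: c_def convex_cone_scaleR)
  have "norm (c n) \<le> C * (1/2)^n" for n
  proof -
    have "norm (c n) \<le> 2^n * (C * norm (z (r n)))"
      using norm_b by (simp add: c_def)
    also have "\<dots> \<le> 2^n * (C * (1/4)^n)"
      using small[of n] \<open>C > 0\<close> by simp
    also have "\<dots> = C * (2 * (1/4))^n"
      unfolding power_mult_distrib by simp
    finally show ?thesis
      by simp
  qed
  then have "summable c"
    by (rule summable_comparison_test'[rotated]) (simp add: summable_geometric summable_mult)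
  have mem: "T (z (r n)) + (1/2)^n *\<^sub>R T (suminf c) \<in> Q" for n
  proof -
    have "2^n *\<^sub>R a (z (r n)) + (suminf c - c n) \<in> P"
      by (intro convex_cone_add convex_cone_scaleR P ab suminf_minus_term_mem_closed_cone c
          \<open>summable c\<close>) simp
    also have "2^n *\<^sub>R a (z (r n)) + (suminf c - c n) = 2^n *\<^sub>R (a (z (r n)) - b (z (r n))) + suminf c"
      by (simp add: c_def algebra_simps)
    also have "\<dots> = 2^n *\<^sub>R z (r n) + suminf c"
      using ab(3) by simp
    finally have "T (2^n *\<^sub>R z (r n) + suminf c) \<in> Q"
      using T(2) unfolding positive_operator_def by blast
    then have "(1/2)^n *\<^sub>R T (2^n *\<^sub>R z (r n) + suminf c) \<in> Q"
      using Q(1) by (simp add: convex_cone_scaleR)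
    then show ?thesis
      by (simp add: add scale scaleR_add_right power_divide)
  qed
  have "(\<lambda>n. T (z (r n)) + (1/2)^n *\<^sub>R T (suminf c)) \<longlonglongrightarrow> w + 0 *\<^sub>R T (suminf c)"
    using LIMSEQ_subseq_LIMSEQ[OF Tz r]
    by (intro tendsto_intros LIMSEQ_power_zero) (simp_all add: o_def)
  then have "w + 0 *\<^sub>R T (suminf c) \<in> Q"
    by (rule closed_sequentially[OF Q(2), rotated]) (rule mem)
  then show ?thesis
    by simp
qed

text \<open>
  Automatic continuity. Apply the one-sided lemma both to a null sequence \<open>z\<close> with
  \<open>T (z n) \<longlonglongrightarrow> w\<close> and to its negative: \<open>w\<close> and \<open>- w\<close> lie in the pointed cone \<open>Q\<close>,
  hence \<open>w = 0\<close> and the graph is closed.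
\<close>

theorem positive_operator_bounded_linear:
  fixes P :: "'e::banach set" and Q :: "'x::banach set"
  assumes P: "convex_cone P" "closed P" "gives_open_decomposition P"
    and Q: "convex_cone Q" "closed Q" "pointed Q"
    and T: "linear T" "positive_operator P Q T"
  shows "bounded_linear T"
proof (rule closed_graph_imp_bounded_linear[OF T(1)])
  interpret linear T by fact
  show "closed (range (\<lambda>x. (x, T x)))"
    unfolding closed_sequential_limits
  proof (intro allI impI, elim conjE)
    fix p l
    assume range: "\<forall>n. p n \<in> range (\<lambda>x. (x, T x))" and lim: "p \<longlonglongrightarrow> l"
    define w where "w = snd l - T (fst l)"
    define z where "z n = fst (p n) - fst l" for n
    have "z \<longlonglongrightarrow> fst l - fst l"
      unfolding z_def by (intro tendsto_intros lim)
    then have z: "z \<longlonglongrightarrow> 0"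
      by simp
    have "T (z n) = snd (p n) - T (fst l)" for n
      using range[rule_format, of n] by (auto simp: z_def diff)
    moreover have "(\<lambda>n. snd (p n) - T (fst l)) \<longlonglongrightarrow> w"
      unfolding w_def by (intro tendsto_intros lim)
    ultimately have Tz: "(\<lambda>n. T (z n)) \<longlonglongrightarrow> w"
      by simp
    have "w \<in> Q"
      using positive_operator_null_sequence_limit[OF P Q(1,2) T z Tz] .
    moreover have "- w \<in> Q"
    proof (rule positive_operator_null_sequence_limit[OF P Q(1,2) T])
      show "(\<lambda>n. - z n) \<longlonglongrightarrow> 0" "(\<lambda>n. T (- z n)) \<longlonglongrightarrow> - w"
        using tendsto_minus[OF z] tendsto_minus[OF Tz] by (simp_all add: neg)
    qed
    ultimately have "w \<in> Q \<inter> uminus ` Q"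
      by (metis IntI imageI minus_minus)
    then have "w \<in> {0}"
      using Q(3) unfolding pointed_def by (rule subst[rotated])
    then have "w = 0"
      by (rule singletonD)
    then have "l = (fst l, T (fst l))"
      by (simp add: w_def prod_eq_iff)
    then show "l \<in> range (\<lambda>x. (x, T x))"
      by blast
  qed
qed

lemma positive_operator_image_cball:
  fixes P :: "'e::banach set" and Q :: "'x::banach set"
  assumes P: "convex_cone P" "closed P" "gives_open_decomposition P"
    and Q: "convex_cone Q" "closed Q" "pointed Q"
    and T: "linear T" "positive_operator P Q T"
  obtains c where
    "T ` cball 0 1 \<subseteq> (\<lambda>(u, v). c *\<^sub>R (u - v)) ` ((Q \<inter> cball 0 1) \<times> (Q \<inter> cball 0 1))"
proof -
  interpret bounded_linear T
    using positive_operator_bounded_linear[OF P Q T] .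
  obtain M where M: "M > 0" "\<And>x. norm (T x) \<le> norm x * M"
    using pos_bounded by blast
  obtain C where C: "C > 0"
    "\<And>x. \<exists>a\<in>P. \<exists>b\<in>P. x = a - b \<and> norm a \<le> C * norm x \<and> norm b \<le> C * norm x"
    using open_decomposition_norm_bound[OF P(3,1)] by blast
  define c where "c = C * M"
  have "c > 0"
    using M(1) C(1) by (simp add: c_def)
  have Q_mem: "(1/c) *\<^sub>R T a \<in> Q \<inter> cball 0 1" if "a \<in> P" "norm a \<le> C" for a
  proof -
    have "T a \<in> Q"
      using T(2) that(1) unfolding positive_operator_def by blast
    moreover have "norm (T a) \<le> c"
      unfolding c_def
      by (rule order_trans[OF M(2) mult_right_mono[OF that(2)]]) (simp add: M(1) less_imp_le)
    ultimately show ?thesis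
      using \<open>c > 0\<close> Q(1) by (simp add: convex_cone_scaleR)
  qed
  have "T x \<in> (\<lambda>(u, v). c *\<^sub>R (u - v)) ` ((Q \<inter> cball 0 1) \<times> (Q \<inter> cball 0 1))"
    if "norm x \<le> 1" for x
  proof -
    obtain a b where ab: "a \<in> P" "b \<in> P" "x = a - b" "norm a \<le> C * norm x" "norm b \<le> C * norm x"
      using C(2) by blast
    have "norm a \<le> C" "norm b \<le> C"
      using ab(4,5) that mult_left_le[of "norm x" C] C(1) by linarith+
    then have "((1/c) *\<^sub>R T a, (1/c) *\<^sub>R T b) \<in> (Q \<inter> cball 0 1) \<times> (Q \<inter> cball 0 1)"
      using Q_mem ab(1,2) by blast
    moreover have "T x = (\<lambda>(u, v). c *\<^sub>R (u - v)) ((1/c) *\<^sub>R T a, (1/c) *\<^sub>R T b)"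
      using \<open>c > 0\<close> by (simp add: ab(3) diff scaleR_diff_right)
    ultimately show ?thesis
      by blast
  qed
  then show thesis
    by (intro that[of c] image_subsetI) simp
qed

section \<open>Compact sets in the weak topology\<close>

lemma continuous_map_weak_topology_functional:
  assumes "bounded_linear f"
  shows "continuous_map weak_topology euclideanreal f"
proof -
  have "openin weak_topology (f -` U)" if "open U" for U
    unfolding weak_topology_def
    using assms that by (intro topology_generated_by_Basis) blast
  then show ?thesis
    by (simp add: continuous_map_def vimage_def)
qed

text \<open>
  A form of complete regularity, by induction on the generation of weakly open sets. A finite
  intersection is handled by the maximum of the gauges, a union by the gauge of one of its members.
\<close>

lemma weak_topology_gauge:
  fixes a :: "'a::real_normed_vector"
  assumes "openin weak_topology U" "a \<in> U"
  obtains g where "continuous_map weak_topology euclideanreal g" "g a = 0" "{x. g x < 1} \<subseteq> U"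
proof -
  have "generate_topology_on {f -` U | (f :: 'a \<Rightarrow> real) U. bounded_linear f \<and> open U} U"
    using assms(1) unfolding weak_topology_def openin_topology_generated_by_iff .
  then have "\<exists>g. continuous_map weak_topology euclideanreal g \<and> g a = 0 \<and> {x. g x < 1} \<subseteq> U"
    using assms(2)
  proof induction
    case (Int U V)
    then obtain g h where "continuous_map weak_topology euclideanreal g" "g a = 0" "{x. g x < 1} \<subseteq> U"
      and "continuous_map weak_topology euclideanreal h" "h a = 0" "{x. h x < 1} \<subseteq> V"
      by auto
    then show ?case
      by (intro exI[of _ "\<lambda>x. max (g x) (h x)"] conjI continuous_map_real_max) auto
  next
    case (UN K)
    then show ?case
      by (meson Sup_upper UnionE order_trans)
  next
    case (Basis U)
    then obtain f :: "'a \<Rightarrow> real" and V where f: "bounded_linear f" "open V" "U = f -` V"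
      by blast
    with Basis have "f a \<in> V"
      by simp
    with f(2) have "\<exists>e>0. ball (f a) e \<subseteq> V"
      by (simp add: open_contains_ball)
    then obtain e where e: "e > 0" "ball (f a) e \<subseteq> V"
      by blast
    show ?case
    proof (intro exI[of _ "\<lambda>x. \<bar>f x - f a\<bar> / e"] conjI)
      show "continuous_map weak_topology euclideanreal (\<lambda>x. \<bar>f x - f a\<bar> / e)"
        using e(1) continuous_map_weak_topology_functional[OF f(1)]
        by (intro continuous_map_real_divide continuous_map_real_abs continuous_map_diff) auto
      show "{x. \<bar>f x - f a\<bar> / e < 1} \<subseteq> U"
        using e f(3) by (auto simp: subset_iff dist_real_def abs_minus_commute)
    qed simp
  qed simp
  then show thesis
    using that by blast
qed

lemma regular_space_weak_topology: "regular_space (weak_topology :: 'a::real_normed_vector topology)"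
  unfolding regular_space_def
proof (intro allI impI, elim conjE DiffE)
  fix C and a :: 'a
  assume "closedin weak_topology C" "a \<notin> C"
  then have "openin weak_topology (- C)" "a \<in> - C"
    by (simp_all add: closedin_def Compl_eq_Diff_UNIV)
  then obtain g where g: "continuous_map weak_topology euclideanreal g" "g a = 0"
    "{x. g x < 1} \<subseteq> - C"
    by (rule weak_topology_gauge)
  have "openin weak_topology {x. g x \<in> {..<1/2}}" "openin weak_topology {x. g x \<in> {1/2<..}}"
    using openin_continuous_map_preimage[OF g(1), of "{..<1/2}"]
      openin_continuous_map_preimage[OF g(1), of "{1/2<..}"]
    by simp_all
  moreover have "C \<subseteq> {x. g x \<in> {1/2<..}}"
    using g(3) by force
  moreover have "a \<in> {x. g x \<in> {..<1/2}}"
    using g(2) by simp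
  moreover have "disjnt {x. g x \<in> {..<1/2}} {x. g x \<in> {1/2<..}}"
    by (auto simp: disjnt_iff)
  ultimately show "\<exists>U V. openin weak_topology U \<and> openin weak_topology V \<and>
      a \<in> U \<and> C \<subseteq> V \<and> disjnt U V"
    by blast
qed

text \<open>
  In a space that need not be Hausdorff, a compact set need not be closed. Regularity still gives a
  compact closure: a finite subfamily of open sets that covers \<open>K\<close> covers the closure of \<open>K\<close> too,
  because \<open>K\<close> can be separated from the complement of their union.
\<close>

lemma regular_space_compactin_closure_of:
  assumes "regular_space X" "compactin X K" "S \<subseteq> K"
  shows "compactin X (X closure_of S)"
proof -
  have "compactin X (X closure_of K)"
    unfolding compactin_def
  proof (intro conjI allI impI, goal_cases)
    case 1
    then show ?case
      by (rule closure_of_subset_topspace)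
  next
    case (2 \<U>)
    then have "K \<subseteq> \<Union>\<U>"
      using closure_of_subset[OF compactin_subset_topspace[OF assms(2)]] by blast
    then obtain \<F> where \<F>: "finite \<F>" "\<F> \<subseteq> \<U>" "K \<subseteq> \<Union>\<F>"
      using assms(2) 2 unfolding compactin_def by blast
    have "openin X (\<Union>\<F>)"
      using \<F>(2) 2 by blast
    then have "closedin X (topspace X - \<Union>\<F>)"
      by blast
    moreover have "disjnt K (topspace X - \<Union>\<F>)"
      using \<F>(3) by (auto simp: disjnt_iff)
    ultimately have "\<exists>U V. openin X U \<and> openin X V \<and> K \<subseteq> U \<and> topspace X - \<Union>\<F> \<subseteq> V \<and> disjnt U V"
      by (rule regular_space_compact_closed_separation[OF assms(1,2)])
    then obtain U V where UV: "openin X U" "openin X V" "K \<subseteq> U" "topspace X - \<Union>\<F> \<subseteq> V"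
        "disjnt U V"
      by (elim exE conjE)
    have "K \<inter> V = {}"
      using UV(3,5) by (auto simp: disjnt_iff)
    then have "V \<inter> X closure_of K = {}"
      using openin_Int_closure_of_eq_empty[OF UV(2)] by blast
    then have "X closure_of K \<subseteq> \<Union>\<F>"
      using UV(4) closure_of_subset_topspace[of X K] by (auto simp: subset_iff disjoint_iff)
    then show ?case
      using \<F> by blast
  qed
  then show ?thesis
    using closed_compactin closedin_closure_of closure_of_mono[OF assms(3)] by metis
qed

lemma continuous_map_weak_topology_scaled_diff:
  "continuous_map (prod_topology weak_topology weak_topology) weak_topology
    (\<lambda>(u, v). c *\<^sub>R (u - v :: 'a::real_normed_vector))"
proof -
  have "openin (prod_topology weak_topology weak_topology)
      ((\<lambda>(u, v). c *\<^sub>R (u - v)) -` (f -` U) \<inter> topspace (prod_topology weak_topology weak_topology))"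
    if f: "bounded_linear f" and "open U" for f :: "'a \<Rightarrow> real" and U
  proof -
    interpret bounded_linear f by fact
    have "continuous_map (prod_topology weak_topology weak_topology) euclideanreal
        (\<lambda>p. c * (f (fst p) - f (snd p)))"
      using continuous_map_weak_topology_functional[OF f]
      by (intro continuous_map_real_mult continuous_map_diff
          continuous_map_compose[OF continuous_map_fst, unfolded o_def]
          continuous_map_compose[OF continuous_map_snd, unfolded o_def]) auto
    then have "openin (prod_topology weak_topology weak_topology)
        {p. c * (f (fst p) - f (snd p)) \<in> U}"
      using openin_continuous_map_preimage \<open>open U\<close> by fastforce
    then show ?thesis
      by (simp add: vimage_def case_prod_beta scale diff)
  qed
  moreover have "UNIV = \<Union> {f -` U | (f :: 'a \<Rightarrow> real) U. bounded_linear f \<and> open U}"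
    using topspace_weak_topology[where 'a = 'a]
    unfolding weak_topology_def topology_generated_by_topspace by (rule sym)
  ultimately show ?thesis
    unfolding weak_topology_def[where 'a = 'a]
    by (intro continuous_on_generated_topo) (auto simp flip: weak_topology_def)
qed

lemma compactin_weak_topology_scaled_diff:
  assumes "compactin weak_topology K"
  shows "compactin weak_topology ((\<lambda>(u, v). c *\<^sub>R (u - v)) ` (K \<times> K))"
proof (rule image_compactin[OF _ continuous_map_weak_topology_scaled_diff])
  show "compactin (prod_topology weak_topology weak_topology) (K \<times> K)"
    using assms by (simp only: compactin_Times simp_thms)
qed

lemma compact_scaled_diff:
  fixes K :: "'a::real_normed_vector set"
  assumes "compact K"
  shows "compact ((\<lambda>(u, v). c *\<^sub>R (u - v)) ` (K \<times> K))"
proof (rule compact_continuous_image)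
  show "continuous_on (K \<times> K) (\<lambda>(u, v). c *\<^sub>R (u - v))"
    unfolding case_prod_beta by (intro continuous_intros)
  show "compact (K \<times> K)"
    using assms assms by (rule compact_Times)
qed

section \<open>Compactness of positive operators\<close>

theorem theorem5p10:
  fixes P :: "'e::banach set" and Q :: "'x::banach set" and T :: "'e \<Rightarrow> 'x"
  assumes "convex_cone P" and "closed P" and "pointed P"
    and "convex_cone Q" and "closed Q" and "pointed Q"
    and "gives_open_decomposition P"
    and "linear T" and "positive_operator P Q T"
  shows "(reflexive_cone Q \<longrightarrow> weakly_compact_operator T) \<and>
         (strongly_reflexive_cone Q \<longrightarrow> compact_operator T)"
proof -
  obtain c where image:
    "T ` cball 0 1 \<subseteq> (\<lambda>(u, v). c *\<^sub>R (u - v)) ` ((Q \<inter> cball 0 1) \<times> (Q \<inter> cball 0 1))"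
    using positive_operator_image_cball[OF assms(1,2,7,4,5,6,8,9)] .
  show ?thesis
  proof (intro conjI impI)
    assume "reflexive_cone Q"
    then show "weakly_compact_operator T"
      unfolding reflexive_cone_def weakly_compact_operator_def
      by (intro regular_space_compactin_closure_of[OF regular_space_weak_topology _ image]
          compactin_weak_topology_scaled_diff)
  next
    assume "strongly_reflexive_cone Q"
    then have K: "compact ((\<lambda>(u, v). c *\<^sub>R (u - v)) ` ((Q \<inter> cball 0 1) \<times> (Q \<inter> cball 0 1)))"
      unfolding strongly_reflexive_cone_def by (rule compact_scaled_diff)
    have "closure (T ` cball 0 1) \<subseteq> (\<lambda>(u, v). c *\<^sub>R (u - v)) ` ((Q \<inter> cball 0 1) \<times> (Q \<inter> cball 0 1))"
      using closure_minimal[OF image compact_imp_closed[OF K]] .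
    then show "compact_operator T"
      unfolding compact_operator_def
      using compact_Int_closed[OF K closed_closure[of "T ` cball 0 1"]] by (simp only: Int_absorb1)
  qed
qed

end
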